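(* Let $q\ge2$ be fixed. Then for every integer $t\ge 2$, \[ \limsup_{n\to\infty}\frac{\log_2 m_q(n,t)}{n}\le (2+o(1))\frac{\log_2 t}{t^2}, \] where $o(1)$ denotes a quantity tending to $0$ as $t\to\infty$. In particular, in the binary case ($q=2$) this bound holds for the maximum size of binary $t$-frameproof codes of length $n$.
   Context: Let $Q=\{0,1,\dots,q-1\}$. For a nonempty set $X=\{\mathbf c^1,\dots,\mathbf c^s\}\subseteq Q^n$, a position $i\in[n]$ is undetectable for $X$ if $c^1_i=\dots=c^s_i$; let $U(X)$ be the set of undetectable positions and $\mathrm{wdesc}(X)=\{\mathbf y\in Q^n: y_i=c^1_i \text{ for all } i\in U(X)\}$. For $t\ge2$, a code $\mathcal C\subseteq Q^n$ is a wide-sense $t$-frameproof code if $\mathrm{wdesc}(X)\cap\mathcal C=X$ for every nonempty $X\subseteq\mathcal C$ with $|X|\le t$; $m_q(n,t)$ is the maximum size of such a code. A binary $t$-frameproof code is $\mathcal C\subseteq\{0,1\}^n$ with $\mathrm{desc}(X)\cap\mathcal C=X$ for all nonempty $X\subseteq\mathcal C$, $|X|\le t$, where $\mathrm{desc}(X)=\{\mathbf y: y_i\in\{c^1_i,\dots,c^s_i\}\ \forall i\}$ (for $q=2$ this coincides with wide-sense). *)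

theory Defs
  imports Complex_Main "HOL-Library.FuncSet" "HOL-Library.Extended_Real" "HOL-Library.Liminf_Limsup"
begin

definition words :: "nat \<Rightarrow> nat \<Rightarrow> (nat \<Rightarrow> nat) set" where
  "words q n = {1..n} \<rightarrow>\<^sub>E {0..<q}"

definition undetectable :: "nat \<Rightarrow> (nat \<Rightarrow> nat) set \<Rightarrow> nat set" where
  "undetectable n X = {i \<in> {1..n}. \<forall>c\<in>X. \<forall>d\<in>X. c i = d i}"

text \<open>For nonempty \<open>X\<close>, all members of \<open>X\<close> agree on \<open>undetectable n X\<close>, so quantifying over
  all of them amounts to comparing with any single one.\<close>

definition wdesc :: "nat \<Rightarrow> nat \<Rightarrow> (nat \<Rightarrow> nat) set \<Rightarrow> (nat \<Rightarrow> nat) set" where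
  "wdesc q n X = {y \<in> words q n. \<forall>i\<in>undetectable n X. \<forall>c\<in>X. y i = c i}"

definition desc :: "nat \<Rightarrow> nat \<Rightarrow> (nat \<Rightarrow> nat) set \<Rightarrow> (nat \<Rightarrow> nat) set" where
  "desc q n X = {y \<in> words q n. \<forall>i\<in>{1..n}. y i \<in> (\<lambda>c. c i) ` X}"

definition wide_sense_frameproof :: "nat \<Rightarrow> nat \<Rightarrow> nat \<Rightarrow> (nat \<Rightarrow> nat) set \<Rightarrow> bool" where
  "wide_sense_frameproof q n t C \<longleftrightarrow> C \<subseteq> words q n \<and>
     (\<forall>X. X \<noteq> {} \<and> X \<subseteq> C \<and> card X \<le> t \<longrightarrow> wdesc q n X \<inter> C = X)"

definition binary_frameproof :: "nat \<Rightarrow> nat \<Rightarrow> (nat \<Rightarrow> nat) set \<Rightarrow> bool" where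
  "binary_frameproof n t C \<longleftrightarrow> C \<subseteq> words 2 n \<and>
     (\<forall>X. X \<noteq> {} \<and> X \<subseteq> C \<and> card X \<le> t \<longrightarrow> desc 2 n X \<inter> C = X)"

definition max_wide_sense :: "nat \<Rightarrow> nat \<Rightarrow> nat \<Rightarrow> nat" where
  "max_wide_sense q n t = Max {card C |C. wide_sense_frameproof q n t C}"

definition max_binary :: "nat \<Rightarrow> nat \<Rightarrow> nat" where
  "max_binary n t = Max {card C |C. binary_frameproof n t C}"

text \<open>The maxima range over finite nonempty sets (the empty code is vacuously frameproof).\<close>

lemma finite_words: "finite (words q n)"
  by (simp add: words_def finite_PiE)

lemma finite_sizes_wide_sense: "finite {card C |C. wide_sense_frameproof q n t C}"
  by (rule finite_subset[of _ "card ` Pow (words q n)"])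
    (auto simp: wide_sense_frameproof_def finite_words)

lemma sizes_wide_sense_nonempty: "{card C |C. wide_sense_frameproof q n t C} \<noteq> {}"
proof -
  have "wide_sense_frameproof q n t {}" by (auto simp: wide_sense_frameproof_def)
  then show ?thesis by blast
qed

lemma finite_sizes_binary: "finite {card C |C. binary_frameproof n t C}"
  by (rule finite_subset[of _ "card ` Pow (words 2 n)"])
    (auto simp: binary_frameproof_def finite_words)

lemma sizes_binary_nonempty: "{card C |C. binary_frameproof n t C} \<noteq> {}"
proof -
  have "binary_frameproof n t {}" by (auto simp: binary_frameproof_def)
  then show ?thesis by blast
qed

end

theory Submission
  imports Defs "HOL-Combinatorics.Permutations" "HOL-Real_Asymp.Real_Asymp"
begin

text \<open>Fix a codeword \<open>x\<close> of a wide-sense \<open>t\<close>-frameproof code. The sets of positions where the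
  other codewords differ from \<open>x\<close> form an \<open>s\<close>-cover-free family with \<open>s = t - 1\<close>, because a
  position is undetectable for a coalition containing \<open>x\<close> iff no member differs from \<open>x\<close> there.
  Cover-free families are bounded by the argument of D'yachkov and Rykov. If every member has at
  most \<open>2 * n / s\<close> points, then averaging over partitions of a \<open>w\<close>-point member into \<open>s\<close> parts shows
  that at least the fraction \<open>1 / s\<close> of its subsets of size \<open>k = \<lceil>w / s\<rceil>\<close> lie in no other member.
  So there are at most \<open>s * (n choose k) / (w choose k)\<close> members with \<open>w\<close> points, and this has
  exponent about \<open>(2 * n / s\<^sup>2) * log s\<close>. If some member has more than \<open>2 * n / s\<close> points, deleting
  its points leaves an \<open>(s - 1)\<close>-cover-free family on fewer than \<open>(1 - 2 / s) * n\<close> points, and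
  induction on \<open>s\<close> applies.\<close>

section \<open>Averaging over permutations\<close>

lemma permutes_image_exists:
  assumes "finite B" "S \<subseteq> B" "T \<subseteq> B" "card S = card T"
  shows "\<exists>p. p permutes B \<and> p ` S = T"
proof -
  have fin: "finite S" "finite T"
    using assms finite_subset by auto
  obtain f where f: "bij_betw f S T"
    using finite_same_card_bij[OF fin assms(4)] by blast
  have "card (B - S) = card (B - T)"
    using assms fin by (simp add: card_Diff_subset)
  then obtain g where g: "bij_betw g (B - S) (B - T)"
    using finite_same_card_bij[of "B - S" "B - T"] assms(1) by auto
  \<comment> \<open>Glues a bijection \<open>S\<close> to \<open>T\<close>, a bijection between the
    complements in \<open>B\<close>, and the identity outside \<open>B\<close>.\<close>
  define p where "p = (\<lambda>x. if x \<in> S then f x else if x \<in> B then g x else x)"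
  have pS: "bij_betw p S T"
    using f by (subst bij_betw_cong[of _ _ f]) (auto simp: p_def)
  have pBS: "bij_betw p (B - S) (B - T)"
    using g by (subst bij_betw_cong[of _ _ g]) (auto simp: p_def)
  have "bij_betw p (S \<union> (B - S)) (T \<union> (B - T))"
    by (rule bij_betw_combine[OF pS pBS]) auto
  then have "bij_betw p B B"
    using assms(2,3) by (simp add: Un_absorb1)
  then have "p permutes B"
    using assms(2) by (intro bij_imp_permutes) (auto simp: p_def)
  moreover have "p ` S = T"
    using pS by (simp add: bij_betw_def)
  ultimately show ?thesis by blast
qed

lemma card_permutes_image_eq:
  assumes B: "finite B" and S: "S \<subseteq> B" "card S = k" and T: "T \<subseteq> B" "card T = k"
  shows "card {p. p permutes B \<and> p ` T = S} * (card B choose k) = fact (card B)"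
proof -
  define K where "K = {S. S \<subseteq> B \<and> card S = k}"
  define N where "N = (\<lambda>S. {p. p permutes B \<and> p ` T = S})"
  have finP: "finite {p. p permutes B}"
    using B by (rule finite_permutations)
  have finK: "finite K"
    using B by (auto simp: K_def)
  have same: "card (N R) = card (N S)" if R: "R \<in> K" for R
  proof -
    obtain r where r: "r permutes B" "r ` S = R"
      using permutes_image_exists[OF B S(1), of R] R S by (auto simp: K_def)
    have inv: "inv r \<circ> r = id" "r \<circ> inv r = id"
      using permutes_inv_o[OF r(1)] by auto
    have "bij_betw (\<lambda>p. r \<circ> p) (N S) (N R)"
    proof (rule bij_betw_byWitness[where f' = "\<lambda>p. inv r \<circ> p"])
      show "\<forall>p\<in>N S. inv r \<circ> (r \<circ> p) = p"
        using inv by (simp add: comp_assoc[symmetric])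
      show "\<forall>p\<in>N R. r \<circ> (inv r \<circ> p) = p"
        using inv by (simp add: comp_assoc[symmetric])
      show "(\<lambda>p. r \<circ> p) ` N S \<subseteq> N R"
        using r by (auto simp: N_def permutes_compose image_comp[symmetric])
      have "inv r ` R = S"
        using r(2) inv(1) by (metis image_comp image_id id_apply)
      then show "(\<lambda>p. inv r \<circ> p) ` N R \<subseteq> N S"
        using permutes_inv[OF r(1)] by (auto simp: N_def permutes_compose image_comp[symmetric])
    qed
    then show ?thesis
      using bij_betw_same_card by fastforce
  qed
  have "{p. p permutes B} = (\<Union>R\<in>K. N R)"
  proof -
    have "p ` T \<in> K" if "p permutes B" for p
      using that T permutes_inj_on[OF that, of T] permutes_image[OF that]
      by (auto simp: K_def card_image)
    then show ?thesis
      by (auto simp: N_def)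
  qed
  then have "fact (card B) = card (\<Union>R\<in>K. N R)"
    using card_permutations[OF refl B] by simp
  also have "\<dots> = (\<Sum>R\<in>K. card (N R))"
    using finK by (intro card_UN_disjoint) (auto simp: N_def intro: finite_subset[OF _ finP])
  also have "\<dots> = card K * card (N S)"
    using same by simp
  also have "card K = card B choose k"
    using n_subsets[OF B] by (simp add: K_def)
  finally show ?thesis
    by (simp add: N_def mult.commute)
qed

lemma binomial_le_mult_card:
  assumes B: "finite B"
    and \<P>: "\<P> \<subseteq> {S. S \<subseteq> B \<and> card S = k}"
    and T: "\<And>j. j < s \<Longrightarrow> T j \<subseteq> B \<and> card (T j) = k"
    and hit: "\<And>p. p permutes B \<Longrightarrow> \<exists>j<s. p ` T j \<in> \<P>"
  shows "card B choose k \<le> s * card \<P>"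
proof -
  define N where "N = (\<lambda>j S. {p. p permutes B \<and> p ` T j = S})"
  have fin: "finite \<P>"
    using \<P> B by (auto intro: finite_subset[of _ "Pow B"])
  have "{p. p permutes B} \<subseteq> (\<Union>j<s. \<Union>S\<in>\<P>. N j S)"
    using hit by (fastforce simp: N_def)
  then have "card {p. p permutes B} \<le> card (\<Union>j<s. \<Union>S\<in>\<P>. N j S)"
    by (rule card_mono[rotated])
      (auto simp: N_def fin intro!: finite_subset[OF _ finite_permutations[OF B]])
  also have "\<dots> \<le> (\<Sum>j<s. card (\<Union>S\<in>\<P>. N j S))"
    by (rule card_UN_le) simp
  also have "\<dots> \<le> (\<Sum>j<s. \<Sum>S\<in>\<P>. card (N j S))"
    by (rule sum_mono, rule card_UN_le[OF fin])
  finally have "fact (card B) \<le> (\<Sum>j<s. \<Sum>S\<in>\<P>. card (N j S))"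
    using card_permutations[OF refl B] by simp
  then have "fact (card B) * (card B choose k)
      \<le> (\<Sum>j<s. \<Sum>S\<in>\<P>. card (N j S)) * (card B choose k)"
    by (rule mult_right_mono) simp
  also have "\<dots> = (\<Sum>j<s. \<Sum>S\<in>\<P>. card (N j S) * (card B choose k))"
    by (simp add: sum_distrib_right)
  also have "\<dots> = (\<Sum>j<s. \<Sum>S\<in>\<P>. fact (card B))"
    unfolding N_def using \<P> T by (intro sum.cong refl card_permutes_image_eq B) auto
  also have "\<dots> = fact (card B) * (s * card \<P>)"
    by simp
  finally show ?thesis
    by (simp add: fact_nonzero)
qed

lemma cover_by_subsets_of_card:
  assumes "finite B" "0 < k" "k \<le> card B" "card B \<le> k * s"
  shows "\<exists>T. (\<forall>j<s. T j \<subseteq> B \<and> card (T j) = k) \<and> B \<subseteq> (\<Union>j<s. T j)"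
proof -
  let ?w = "card B"
  obtain h where h: "bij_betw h {0..<?w} B"
    using ex_bij_betw_nat_finite[OF assms(1)] by blast
  \<comment> \<open>Consecutive blocks of length \<open>k\<close>. The \<open>min\<close> shifts a
    block that would run past the end back inside, so blocks may overlap but all have exactly
    \<open>k\<close> points, and \<open>i\<close> still lies in block
    \<open>i div k\<close>.\<close>
  define I where "I = (\<lambda>j. {min (j * k) (?w - k)..<min (j * k) (?w - k) + k})"
  have I: "I j \<subseteq> {0..<?w}" for j
    using assms(3) by (auto simp: I_def)
  have "card (h ` I j) = k" for j
    using h I[of j] by (subst card_image) (auto simp: bij_betw_def inj_on_subset I_def)
  moreover have "h ` I j \<subseteq> B" for j
    using h I[of j] by (auto simp: bij_betw_def)
  moreover have "B \<subseteq> (\<Union>j<s. h ` I j)"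
  proof
    fix x assume "x \<in> B"
    then obtain i where i: "i < ?w" "x = h i"
      using h by (metis atLeastLessThan_iff bij_betw_def imageE)
    have "i div k < s"
      using i(1) assms(4) by (simp add: less_mult_imp_div_less mult.commute)
    moreover have "i \<in> I (i div k)"
    proof -
      have "(i div k) * k \<le> i" "i < (i div k) * k + k"
        using dividend_less_div_times[of k i] assms(2) by (auto simp: add.commute)
      then have "min (i div k * k) (?w - k) \<le> i" "i < min (i div k * k) (?w - k) + k"
        using i(1) assms(3) by linarith+
      then show ?thesis
        by (simp add: I_def)
    qed
    ultimately show "x \<in> (\<Union>j<s. h ` I j)"
      using i(2) by blast
  qed
  ultimately show ?thesis
    by (intro exI[of _ "\<lambda>j. h ` I j"]) auto
qed

section \<open>Cover-free families\<close>

text \<open>The condition \<open>finite G\<close> is explicit because \<open>card\<close> is 0 on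
  infinite sets. Taking \<open>G\<close> empty shows that no member is empty.\<close>

definition cover_free :: "nat \<Rightarrow> 'a set set \<Rightarrow> bool" where
  "cover_free s F \<longleftrightarrow> (\<forall>A\<in>F. \<forall>G\<subseteq>F - {A}. finite G \<and> card G \<le> s \<longrightarrow> \<not> A \<subseteq> \<Union>G)"

text \<open>These are the own subsets of Erdos, Frankl and Furedi. Such a set identifies its member,
  so different members of \<open>F\<close> share none.\<close>

definition private_subset :: "'a set set \<Rightarrow> 'a set \<Rightarrow> 'a set \<Rightarrow> bool" where
  "private_subset F A S \<longleftrightarrow> S \<subseteq> A \<and> (\<forall>A'\<in>F - {A}. \<not> S \<subseteq> A')"

lemma cover_freeD:
  "cover_free s F \<Longrightarrow> A \<in> F \<Longrightarrow> G \<subseteq> F - {A} \<Longrightarrow> finite G \<Longrightarrow> card G \<le> s \<Longrightarrow> \<not> A \<subseteq> \<Union>G"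
  by (simp add: cover_free_def)

lemma cover_free_subset: "cover_free s F \<Longrightarrow> G \<subseteq> F \<Longrightarrow> cover_free s G"
  unfolding cover_free_def by (meson Diff_mono order_refl subsetD subset_trans)

text \<open>Otherwise each of the \<open>s\<close> pieces lies in another member, and these at most
  \<open>s\<close> members cover \<open>A\<close>.\<close>

lemma cover_free_private_subset:
  assumes "cover_free s F" "A \<in> F" "\<And>j. j < s \<Longrightarrow> T j \<subseteq> A" "A \<subseteq> (\<Union>j<s. T j)"
  shows "\<exists>j<s. private_subset F A (T j)"
proof (rule ccontr)
  assume "\<not> ?thesis"
  then have "\<forall>j<s. \<exists>A'\<in>F - {A}. T j \<subseteq> A'"
    using assms(3) by (auto simp: private_subset_def)
  then obtain h where h: "\<And>j. j < s \<Longrightarrow> h j \<in> F - {A} \<and> T j \<subseteq> h j"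
    by metis
  have "\<not> A \<subseteq> \<Union>(h ` {..<s})"
    using h card_image_le[of "{..<s}" h] by (intro cover_freeD[OF assms(1,2)]) auto
  then show False
    using assms(4) h by fastforce
qed

lemma card_private_subsets:
  assumes "cover_free s F" "A \<in> F" "finite A" "0 < k" "k \<le> card A" "card A \<le> k * s"
  shows "card A choose k \<le> s * card {S. private_subset F A S \<and> card S = k}"
proof -
  obtain T where T: "\<And>j. j < s \<Longrightarrow> T j \<subseteq> A \<and> card (T j) = k" "A \<subseteq> (\<Union>j<s. T j)"
    using cover_by_subsets_of_card[OF assms(3-6)] by blast
  show ?thesis
  proof (rule binomial_le_mult_card[OF assms(3)])
    show "{S. private_subset F A S \<and> card S = k} \<subseteq> {S. S \<subseteq> A \<and> card S = k}"
      by (auto simp: private_subset_def)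
    show "T j \<subseteq> A \<and> card (T j) = k" if "j < s" for j
      using T(1)[OF that] .
    \<comment> \<open>A permutation of \<open>A\<close> turns the chosen cover into another cover by
      \<open>k\<close>-subsets, and every such cover contains a private subset.\<close>
    fix p assume p: "p permutes A"
    have cov: "A \<subseteq> (\<Union>j<s. p ` T j)"
      using image_mono[OF T(2), of p] permutes_image[OF p] by (simp add: image_UN)
    have sub: "p ` T j \<subseteq> A" if "j < s" for j
      using image_mono[of "T j" A p] T(1)[OF that] permutes_image[OF p] by simp
    obtain j where "j < s" "private_subset F A (p ` T j)"
      using cover_free_private_subset[OF assms(1,2), of "\<lambda>j. p ` T j"] cov sub by blast
    moreover have "card (p ` T j) = k"
      using T(1)[OF \<open>j < s\<close>] permutes_inj_on[OF p] by (simp add: card_image)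
    ultimately show "\<exists>j<s. p ` T j \<in> {S. private_subset F A S \<and> card S = k}"
      by blast
  qed
qed

text \<open>Each member owns at least \<open>(w choose k) / s\<close> private
  \<open>k\<close>-subsets. Those of different members are distinct, and \<open>V\<close> has only
  \<open>card V choose k\<close> subsets of that size.\<close>

lemma card_uniform_cover_free:
  assumes "cover_free s F" "finite V" "F \<subseteq> Pow V" "\<And>A. A \<in> F \<Longrightarrow> card A = w"
    and "0 < k" "k \<le> w" "w \<le> k * s"
  shows "card F * (w choose k) \<le> s * (card V choose k)"
proof -
  define P where "P = (\<lambda>A. {S. private_subset F A S \<and> card S = k})"
  have finF: "finite F"
    using assms(2,3) finite_subset by auto
  have sub: "P A \<subseteq> {S. S \<subseteq> V \<and> card S = k}" if "A \<in> F" for A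
    using assms(3) that by (auto simp: P_def private_subset_def)
  have finP: "finite (P A)" if "A \<in> F" for A
    using sub[OF that] assms(2) by (auto intro: finite_subset[of _ "Pow V"])
  have "card F * (w choose k) = (\<Sum>A\<in>F. w choose k)"
    by simp
  also have "\<dots> \<le> (\<Sum>A\<in>F. s * card (P A))"
  proof (rule sum_mono)
    fix A assume A: "A \<in> F"
    then have "finite A"
      using assms(2,3) by (meson PowD finite_subset subsetD)
    then show "w choose k \<le> s * card (P A)"
      using card_private_subsets[OF assms(1) A, of k] assms(4)[OF A] assms(5-7)
      by (simp add: P_def)
  qed
  also have "\<dots> = s * card (\<Union>A\<in>F. P A)"
  proof -
    have "card (\<Union>A\<in>F. P A) = (\<Sum>A\<in>F. card (P A))"
      using finF finP by (intro card_UN_disjoint) (auto simp: P_def private_subset_def)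
    then show ?thesis
      by (simp add: sum_distrib_left)
  qed
  also have "card (\<Union>A\<in>F. P A) \<le> card {S. S \<subseteq> V \<and> card S = k}"
    using sub assms(2) by (intro card_mono UN_least) auto
  also have "\<dots> = card V choose k"
    using n_subsets[OF assms(2)] by simp
  finally show ?thesis by simp
qed

text \<open>If \<open>s\<close> of the trimmed sets covered \<open>A - B\<close>, their originals
  together with \<open>B\<close> would be \<open>s + 1\<close> members covering \<open>A\<close>.
  Injectivity uses the pair \<open>{A', B}\<close>, hence \<open>s \<ge> 1\<close>.\<close>

lemma cover_free_remove_member:
  assumes cf: "cover_free (Suc s) F" and B: "B \<in> F" and s: "s \<ge> 1"
  shows "inj_on (\<lambda>A. A - B) (F - {B})"
    and "cover_free s ((\<lambda>A. A - B) ` (F - {B}))"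
proof -
  show inj: "inj_on (\<lambda>A. A - B) (F - {B})"
  proof (rule inj_onI, rule ccontr)
    fix A A' assume A: "A \<in> F - {B}" "A' \<in> F - {B}" "A - B = A' - B" "A \<noteq> A'"
    have "\<not> A \<subseteq> \<Union>{A', B}"
      using A B s by (intro cover_freeD[OF cf]) (auto simp: card_insert_if)
    then show False
      using A(3) by auto
  qed
  show "cover_free s ((\<lambda>A. A - B) ` (F - {B}))"
    unfolding cover_free_def
  proof (intro ballI allI impI)
    fix A' G'
    assume A': "A' \<in> (\<lambda>A. A - B) ` (F - {B})"
      and G': "G' \<subseteq> (\<lambda>A. A - B) ` (F - {B}) - {A'}" "finite G' \<and> card G' \<le> s"
    obtain A where A: "A \<in> F - {B}" "A' = A - B"
      using A' by blast
    obtain G where G: "G \<subseteq> F - {B}" "inj_on (\<lambda>A. A - B) G" "G' = (\<lambda>A. A - B) ` G"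
    proof -
      have "G' \<subseteq> (\<lambda>A. A - B) ` (F - {B})"
        using G'(1) by blast
      then show ?thesis
        using that unfolding subset_image_inj by metis
    qed
    have fin: "finite G" "card G \<le> s"
      using G G'(2) by (auto simp: card_image finite_image_iff)
    have "A \<notin> G"
      using G(3) G'(1) A(2) by blast
    then have "\<not> A \<subseteq> \<Union>(insert B G)"
      using A G B fin by (intro cover_freeD[OF cf]) (auto simp: card_insert_if)
    then show "\<not> A' \<subseteq> \<Union>G'"
      using A(2) G(3) by auto
  qed
qed

section \<open>The D'yachkov--Rykov bound\<close>

lemma power_self_le_fact_exp: "real k ^ k \<le> fact k * exp (real k)"
proof -
  have "(\<Sum>i\<in>{k}. real k ^ i /\<^sub>R fact i) \<le> (\<Sum>i. real k ^ i /\<^sub>R fact i)"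
    using exp_converges[of "real k"] by (intro sum_le_suminf) (auto simp: sums_iff)
  also have "\<dots> = exp (real k)"
    using exp_converges[of "real k"] by (simp add: sums_iff)
  finally show ?thesis
    by (simp add: field_simps)
qed

text \<open>Combines \<open>n choose k \<le> n^k / k!\<close> and
  \<open>w choose k \<ge> (w/k)^k\<close> with the weak Stirling bound
  \<open>k^k \<le> k! * e^k\<close>, whose source is a single term of the exponential
  series.\<close>

lemma binomial_ratio_le:
  assumes "0 < k" "k \<le> w"
  shows "real (n choose k) \<le> (exp 1 * real n / real w) ^ k * real (w choose k)"
proof -
  have "real (n choose k) * fact k \<le> real n ^ k"
    using binomial_fact_pow[of n k] by (metis of_nat_fact of_nat_le_iff of_nat_mult of_nat_power)
  moreover have "real w ^ k \<le> real (w choose k) * real k ^ k"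
    using binomial_ge_n_over_k_pow_k[OF assms(2), where 'a = real] assms(1)
    by (simp add: power_divide field_simps)
  then have "real w ^ k \<le> real (w choose k) * (fact k * exp (real k))"
    by (rule order_trans) (intro mult_left_mono power_self_le_fact_exp, simp)
  ultimately have "(real (n choose k) * fact k) * real w ^ k
      \<le> real n ^ k * (real (w choose k) * (fact k * exp (real k)))"
    by (intro mult_mono) auto
  then have "fact k * (real (n choose k) * real w ^ k)
      \<le> fact k * (real n ^ k * (real (w choose k) * exp (real k)))"
    by (simp only: mult_ac)
  then have "real (n choose k) * real w ^ k \<le> real n ^ k * (real (w choose k) * exp 1 ^ k)"
    by (simp add: exp_of_nat_mult[symmetric])
  then show ?thesis
    using assms by (simp add: power_divide power_mult_distrib field_simps)
qed

text \<open>The derivative in \<open>w\<close> is \<open>ln (n / w)\<close>, nonnegative up to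
  \<open>n\<close>. The proof replaces calculus by \<open>ln x \<le> x - 1\<close> at
  \<open>x = W / w\<close>.\<close>

lemma mult_ln_quotient_mono:
  fixes w W n :: real
  assumes "0 < w" "w \<le> W" "W \<le> n"
  shows "w * (1 + ln (n / w)) \<le> W * (1 + ln (n / W))"
proof -
  have "ln (W / w) \<le> W / w - 1"
    using assms by (intro ln_le_minus_one) simp
  then have "w * ln (W / w) \<le> w * (W / w - 1)"
    using assms(1) by (intro mult_left_mono) auto
  also have "w * (W / w - 1) = W - w"
    using assms(1) by (simp add: right_diff_distrib)
  finally have "w * ln (W / w) \<le> W - w" .
  moreover have "ln (n / w) = ln (n / W) + ln (W / w)"
    using assms by (simp add: ln_div)
  moreover have "w * ln (n / W) \<le> W * ln (n / W)"
    using assms by (intro mult_right_mono) auto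
  ultimately show ?thesis
    by (simp add: algebra_simps)
qed

text \<open>An exponent in natural logarithms. The counting argument yields the smaller
  \<open>2 * (1 + ln (s / 2)) / s^2\<close>; this weaker form is the one preserved by the induction
  on \<open>s\<close>.\<close>

definition dr_rate :: "nat \<Rightarrow> real" where
  "dr_rate s = 2 * (1 + ln (real s)) / (real s * (real s - 1))"

lemma card_uniform_small_cover_free:
  assumes cf: "cover_free s F" and V: "finite V" "F \<subseteq> Pow V"
    and w: "\<And>A. A \<in> F \<Longrightarrow> card A = w" "0 < w" "real w \<le> 2 * real (card V) / real s" and s: "s \<ge> 2"
  shows "real (card F) \<le> 3 * real s * real (card V) * exp (dr_rate s * real (card V))"
proof (cases "F = {}")
  case False
  let ?n = "card V"
  \<comment> \<open>This is \<open>w / s\<close> rounded up, the least block size for which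
    \<open>s\<close> blocks can cover \<open>w\<close> points.\<close>
  define k where "k = (w + s - 1) div s"
  have k: "0 < k" "w \<le> k * s" "k * s \<le> w + s - 1"
  proof -
    have "w + s - 1 < k * s + s"
      using dividend_less_div_times[of s "w + s - 1"] s by (simp add: k_def add.commute)
    then show "w \<le> k * s"
      by linarith
    then show "0 < k"
      using w(2) by (cases k) auto
    show "k * s \<le> w + s - 1"
      by (simp add: k_def)
  qed
  have "k \<le> w"
  proof -
    have "w + s - 1 \<le> w * s"
      using w(2) s by (cases w; cases s) auto
    then have "k * s \<le> w * s"
      using k(3) by linarith
    then show ?thesis
      using s by simp
  qed
  obtain A where "A \<in> F" using False by blast
  then have wn: "w \<le> ?n"
    using w(1) V card_mono[of V A] by auto
  have W: "2 * real ?n / real s \<le> real ?n"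
    using s by (simp add: divide_le_eq mult.commute[of 2] mult_left_mono)
  define r where "r = exp 1 * real ?n / real w"
  have r1: "1 \<le> r"
  proof -
    have "real w \<le> 1 * real ?n" using wn by simp
    also have "\<dots> \<le> exp 1 * real ?n"
      by (intro mult_right_mono) auto
    finally show ?thesis
      using w(2) by (simp add: r_def)
  qed
  have "real (card F) * real (w choose k) \<le> real s * real (?n choose k)"
    using card_uniform_cover_free[OF cf V w(1) k(1) \<open>k \<le> w\<close> k(2)]
    by (metis of_nat_le_iff of_nat_mult)
  also have "\<dots> \<le> real s * (r ^ k * real (w choose k))"
    unfolding r_def by (intro mult_left_mono binomial_ratio_le k \<open>k \<le> w\<close>) auto
  finally have "real (card F) * real (w choose k) \<le> (real s * r ^ k) * real (w choose k)"
    by simp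
  then have "real (card F) \<le> real s * r ^ k"
    using \<open>k \<le> w\<close> by (simp add: mult_le_cancel_right)
  \<comment> \<open>Since \<open>k \<le> w / s + 1\<close>, rounding up costs only one extra factor
    \<open>r\<close>, which is later bounded by \<open>3 * n\<close>.\<close>
  also have "r ^ k \<le> r * exp (dr_rate s * real ?n)"
  proof -
    have rpos: "0 < r" using r1 by linarith
    have lr: "ln r = 1 + ln (real ?n / real w)"
      using w(2) wn by (simp add: r_def ln_mult ln_div)
    have "real (k * s) \<le> real (w + s)"
      using k(3) by (intro of_nat_mono) linarith
    then have "real k \<le> real w / real s + 1"
      using s by (simp add: field_simps)
    then have "real k * ln r \<le> (real w / real s + 1) * ln r"
      using r1 by (intro mult_right_mono) auto
    also have "\<dots> = real w * (1 + ln (real ?n / real w)) / real s + ln r"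
      by (simp add: lr algebra_simps add_divide_distrib)
    \<comment> \<open>The exponent increases with \<open>w\<close>, so the worst case is the largest
      permitted size, \<open>2 * n / s\<close>.\<close>
    also have "real w * (1 + ln (real ?n / real w))
        \<le> 2 * real ?n / real s * (1 + ln (real ?n / (2 * real ?n / real s)))"
      using w W by (intro mult_ln_quotient_mono) auto
    also have "real ?n / (2 * real ?n / real s) = real s / 2"
      using w(2) wn by simp
    also have "2 * real ?n / real s * (1 + ln (real s / 2)) / real s \<le> dr_rate s * real ?n"
    proof -
      have "ln (real s / 2) \<le> ln (real s)"
        using s by simp
      moreover have "0 \<le> ln (real s)"
        using s by simp
      ultimately have "2 * (1 + ln (real s / 2)) / (real s * real s)
          \<le> 2 * (1 + ln (real s)) / (real s * (real s - 1))"
        using s by (intro frac_le mult_left_mono mult_pos_pos) auto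
      then have "2 * (1 + ln (real s / 2)) / (real s * real s) * real ?n \<le> dr_rate s * real ?n"
        unfolding dr_rate_def by (rule mult_right_mono) simp
      then show ?thesis
        by (simp add: field_simps)
    qed
    finally have "real k * ln r \<le> dr_rate s * real ?n + ln r"
      using s by (simp add: divide_right_mono)
    then have "exp (real k * ln r) \<le> exp (dr_rate s * real ?n + ln r)"
      by simp
    then show ?thesis
      using rpos by (simp add: exp_add exp_of_nat_mult mult.commute)
  qed
  also have "r \<le> 3 * real ?n"
  proof -
    have "r \<le> exp 1 * real ?n / 1"
      unfolding r_def using w(2) by (intro divide_left_mono) auto
    also have "\<dots> \<le> 3 * real ?n"
      using exp_le by (simp add: mult_right_mono)
    finally show ?thesis .
  qed
  finally show ?thesis
    by (simp add: mult_left_mono mult_right_mono algebra_simps)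
qed simp

text \<open>Sorting members by size gives uniform families. Summing over the sizes
  \<open>1..n\<close> costs a second factor \<open>n\<close>, and using \<open>1 + n\<close> also
  absorbs the class of size 0.\<close>

lemma card_small_cover_free:
  assumes cf: "cover_free s F" and V: "finite V" "F \<subseteq> Pow V"
    and small: "\<And>A. A \<in> F \<Longrightarrow> real (card A) \<le> 2 * real (card V) / real s" and s: "s \<ge> 2"
  shows "real (card F) \<le> 3 * real s * (1 + real (card V))\<^sup>2 * exp (dr_rate s * real (card V))"
proof -
  let ?n = "card V"
  let ?E = "exp (dr_rate s * real ?n)"
  define L where "L = (\<lambda>w. {A \<in> F. card A = w})"
  have finV: "finite A" "card A \<le> ?n" if "A \<in> F" for A
    using that V by (auto intro: finite_subset card_mono)
  have E1: "1 \<le> ?E"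
    using s by (simp add: dr_rate_def)
  have "L 0 \<subseteq> {{}}"
    using finV by (auto simp: L_def)
  then have L0: "card (L 0) \<le> 1"
    using card_mono[of "{{}}" "L 0"] by simp
  have Lw: "real (card (L w)) \<le> 3 * real s * real ?n * ?E" if "w \<in> {1..?n}" for w
  proof (cases "L w = {}")
    case False
    then obtain A where "A \<in> F" "card A = w"
      by (auto simp: L_def)
    then have "real w \<le> 2 * real ?n / real s"
      using small by blast
    then show ?thesis
      using that V s
      by (intro card_uniform_small_cover_free[where w = w] cover_free_subset[OF cf])
        (auto simp: L_def)
  qed simp
  have "F = L 0 \<union> (\<Union>w\<in>{1..?n}. L w)"
    using finV(2) by (fastforce simp: L_def Suc_le_eq)
  then have "card F \<le> card (L 0) + card (\<Union>w\<in>{1..?n}. L w)"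
    by (metis card_Un_le)
  also have "\<dots> \<le> 1 + (\<Sum>w\<in>{1..?n}. card (L w))"
    using L0 by (intro add_mono card_UN_le) auto
  finally have "real (card F) \<le> 1 + (\<Sum>w\<in>{1..?n}. real (card (L w)))"
    by (metis of_nat_1 of_nat_add of_nat_le_iff of_nat_sum)
  also have "\<dots> \<le> 1 + real ?n * (3 * real s * real ?n * ?E)"
    using sum_bounded_above[of "{1..?n}" "\<lambda>w. real (card (L w))", OF Lw] by simp
  also have "\<dots> \<le> 3 * real s * ?E + real ?n * (3 * real s * real ?n * ?E)"
  proof -
    have "1 * 1 \<le> (3 * real s) * ?E"
      using s E1 by (intro mult_mono) auto
    then show ?thesis by simp
  qed
  also have "\<dots> = (3 * real s * ?E) * (1 + real ?n * real ?n)"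
    by (simp add: algebra_simps)
  also have "\<dots> \<le> (3 * real s * ?E) * (1 + real ?n)\<^sup>2"
    by (intro mult_left_mono) (auto simp: power2_eq_square algebra_simps)
  finally show ?thesis
    by (simp add: mult_ac)
qed

text \<open>Deleting a member with more than \<open>2 * n / Suc s\<close> points multiplies the number of
  points by at most \<open>(s - 1) / Suc s\<close>; these factors telescope against the denominators
  \<open>s * (s - 1)\<close> of \<open>dr_rate\<close>.\<close>

lemma dr_rate_step:
  fixes m n :: real
  assumes "s \<ge> 2" "0 \<le> n" "m \<le> n - 2 * n / real (Suc s)"
  shows "dr_rate s * m \<le> dr_rate (Suc s) * n"
proof -
  have pos: "0 \<le> ln (real s)" "real s > 1"
    using assms(1) by auto
  have "dr_rate s * m \<le> dr_rate s * (n - 2 * n / real (Suc s))"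
    using assms pos by (intro mult_left_mono) (auto simp: dr_rate_def)
  also have "\<dots> = 2 * (1 + ln (real s)) / (real (Suc s) * real s) * n"
  proof -
    have "n - 2 * n / real (Suc s) = n * (real s - 1) / (real s + 1)"
      by (simp add: field_simps)
    then show ?thesis
      using pos by (simp add: dr_rate_def add.commute)
  qed
  also have "\<dots> \<le> 2 * (1 + ln (real (Suc s))) / (real (Suc s) * real s) * n"
    using pos assms(2) by (intro mult_right_mono divide_right_mono mult_left_mono add_left_mono) auto
  finally show ?thesis
    by (simp add: dr_rate_def)
qed

theorem card_cover_free:
  assumes "s \<ge> 2" "cover_free s F" "finite V" "F \<subseteq> Pow V"
  shows "real (card F) \<le> 3 * real s * (1 + real (card V))\<^sup>2 * exp (dr_rate s * real (card V))"
  using assms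
proof (induction s arbitrary: F V rule: nat_induct_at_least)
  case base
  \<comment> \<open>For \<open>s = 2\<close> the threshold \<open>2 * n / s\<close> is
    \<open>n\<close> itself, so every member is small.\<close>
  have "real (card A) \<le> 2 * real (card V) / real 2" if "A \<in> F" for A
    using that base card_mono[of V A] by auto
  then show ?case
    using card_small_cover_free[of 2] base by blast
next
  case (Suc s F V)
  let ?n = "card V"
  show ?case
  proof (cases "\<forall>A\<in>F. real (card A) \<le> 2 * real ?n / real (Suc s)")
    case True
    then show ?thesis
      using Suc.hyps Suc.prems by (intro card_small_cover_free) auto
  next
    case False
    then obtain B where B: "B \<in> F" "2 * real ?n / real (Suc s) < real (card B)"
      by force
    have finF: "finite F" and BV: "B \<subseteq> V"
      using Suc.prems B finite_subset by auto
    let ?F' = "(\<lambda>A. A - B) ` (F - {B})"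
    let ?n' = "card (V - B)"
    let ?E = "exp (dr_rate (Suc s) * real ?n)"
    have n': "real ?n' = real ?n - real (card B)" "?n' \<le> ?n"
      using BV Suc.prems(2) card_mono[OF Suc.prems(2) BV]
      by (auto simp: card_Diff_subset finite_subset of_nat_diff)
    have E1: "1 \<le> ?E"
      using Suc.hyps by (simp add: dr_rate_def)
    note rem = cover_free_remove_member[OF Suc.prems(1) B(1)]
    have "card F = Suc (card (F - {B}))"
      using finF B(1) by (metis card_Suc_Diff1)
    also have "card (F - {B}) = card ?F'"
      using rem(1) Suc.hyps by (simp add: card_image)
    finally have "real (card F) = 1 + real (card ?F')"
      by simp
    also have "real (card ?F') \<le> 3 * real s * (1 + real ?n')\<^sup>2 * exp (dr_rate s * real ?n')"
      using Suc.hyps Suc.prems rem(2) by (intro Suc.IH) auto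
    also have "\<dots> \<le> 3 * real s * (1 + real ?n)\<^sup>2 * ?E"
      using n' B(2) Suc.hyps by (intro mult_mono power_mono) (auto intro!: dr_rate_step)
    \<comment> \<open>The deleted member \<open>B\<close> contributes the 1, absorbed when the
      prefactor grows from \<open>3 * s\<close> to \<open>3 * (s + 1)\<close>.\<close>
    also have "1 + \<dots> \<le> 3 * real (Suc s) * (1 + real ?n)\<^sup>2 * ?E"
    proof -
      have "1 * 1 \<le> (3 * (1 + real ?n)\<^sup>2) * ?E"
      proof (rule mult_mono)
        have "1 \<le> (1 + real ?n)\<^sup>2"
          by (simp add: one_le_power)
        then show "1 \<le> 3 * (1 + real ?n)\<^sup>2"
          by linarith
      qed (use E1 in auto)
      then show ?thesis
        by (simp add: algebra_simps)
    qed
    finally show ?thesis by simp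
  qed
qed

section \<open>Frameproof codes\<close>

definition diff_set :: "nat \<Rightarrow> (nat \<Rightarrow> nat) \<Rightarrow> (nat \<Rightarrow> nat) \<Rightarrow> nat set" where
  "diff_set n x c = {i \<in> {1..n}. c i \<noteq> x i}"

lemma wide_sense_frameproof_finite: "wide_sense_frameproof q n t C \<Longrightarrow> finite C"
  unfolding wide_sense_frameproof_def by (metis finite_words finite_subset)

text \<open>A position where all of \<open>Y\<close> agrees with \<open>x\<close> would be one where
  \<open>c\<close> does too, putting \<open>c\<close> into the wide-sense descendants of
  \<open>insert x Y\<close>. Adding \<open>x\<close> explains \<open>card Y < t\<close>. Only
  whether symbols differ matters, so the final bound is independent of \<open>q\<close>.\<close>

lemma diff_set_not_covered:
  assumes wf: "wide_sense_frameproof q n t C" and "x \<in> C" "c \<in> C" "c \<noteq> x"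
    and Y: "Y \<subseteq> C - {c}" "card Y < t"
  shows "\<not> diff_set n x c \<subseteq> \<Union>(diff_set n x ` Y)"
proof
  assume cov: "diff_set n x c \<subseteq> \<Union>(diff_set n x ` Y)"
  let ?X = "insert x Y"
  have "finite Y"
    using wide_sense_frameproof_finite[OF wf] Y(1) finite_subset by blast
  then have "card ?X \<le> t"
    using Y(2) by (simp add: card_insert_if)
  then have X: "wdesc q n ?X \<inter> C = ?X"
    using wf assms(2) Y(1) unfolding wide_sense_frameproof_def
    by (metis Diff_subset insert_not_empty insert_subset subset_trans)
  have "c i = d i" if i: "i \<in> undetectable n ?X" and d: "d \<in> ?X" for i d
  proof -
    have "i \<in> {1..n}" "\<forall>y\<in>?X. y i = x i"
      using i unfolding undetectable_def by auto
    then show ?thesis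
      using cov d unfolding diff_set_def by fastforce
  qed
  then have "c \<in> wdesc q n ?X"
    using wf assms(3) by (auto simp: wdesc_def wide_sense_frameproof_def)
  then show False
    using X assms(3,4) Y(1) by blast
qed

text \<open>Injectivity is the case of a single codeword \<open>Y = {d}\<close>. For cover-freeness,
  a subfamily is lifted to equally many codewords, so that its size bounds the coalition.\<close>

lemma cover_free_diff_sets:
  assumes wf: "wide_sense_frameproof q n (Suc s) C" and x: "x \<in> C" and s: "s \<ge> 1"
  shows "inj_on (diff_set n x) (C - {x})" "cover_free s (diff_set n x ` (C - {x}))"
proof -
  show "inj_on (diff_set n x) (C - {x})"
  proof (rule inj_onI, rule ccontr)
    fix c d assume "c \<in> C - {x}" "d \<in> C - {x}" "diff_set n x c = diff_set n x d" "c \<noteq> d"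
    then show False
      using diff_set_not_covered[OF wf x, of c "{d}"] s by auto
  qed
  show "cover_free s (diff_set n x ` (C - {x}))"
    unfolding cover_free_def
  proof (intro ballI allI impI)
    fix A G
    assume "A \<in> diff_set n x ` (C - {x})"
      and G: "G \<subseteq> diff_set n x ` (C - {x}) - {A}" "finite G \<and> card G \<le> s"
    then obtain c where c: "c \<in> C - {x}" "A = diff_set n x c"
      by blast
    obtain Y where Y: "Y \<subseteq> C - {x}" "inj_on (diff_set n x) Y" "G = diff_set n x ` Y"
    proof -
      have "G \<subseteq> diff_set n x ` (C - {x})"
        using G(1) by blast
      then show ?thesis
        using that unfolding subset_image_inj by metis
    qed
    have "c \<notin> Y"
      using Y(3) G(1) c(2) by blast
    then show "\<not> A \<subseteq> \<Union>G"
      using diff_set_not_covered[OF wf x, of c Y] c Y G(2) by (auto simp: card_image)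
  qed
qed

text \<open>The bound \<open>b\<close> is left abstract so that it can come either from the trivial
  count of all subsets or from \<open>card_cover_free\<close>. The extra 1 counts the fixed
  codeword.\<close>

lemma card_wide_sense_frameproof:
  assumes wf: "wide_sense_frameproof q n (Suc s) C" and s: "s \<ge> 1"
    and F: "\<And>F :: nat set set. cover_free s F \<Longrightarrow> F \<subseteq> Pow {1..n} \<Longrightarrow> real (card F) \<le> b"
    and b: "0 \<le> b"
  shows "real (card C) \<le> 1 + b"
proof (cases "C = {}")
  case False
  then obtain x where x: "x \<in> C" by blast
  have "card C = Suc (card (C - {x}))"
    using card_Suc_Diff1[OF wide_sense_frameproof_finite[OF wf] x] by simp
  also have "card (C - {x}) = card (diff_set n x ` (C - {x}))"
    using cover_free_diff_sets(1)[OF wf x s] by (simp add: card_image)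
  finally show ?thesis
    using F[OF cover_free_diff_sets(2)[OF wf x s]] by (fastforce simp: diff_set_def)
qed (use b in simp)

section \<open>Binary codes and maximal sizes\<close>

lemma binary_frameproof_wide_sense:
  assumes "binary_frameproof n t C"
  shows "wide_sense_frameproof 2 n t C"
proof -
  have C: "C \<subseteq> words 2 n"
    using assms by (simp add: binary_frameproof_def)
  have "wdesc 2 n X \<inter> C = X" if X: "X \<noteq> {}" "X \<subseteq> C" "card X \<le> t" for X
  proof
    \<comment> \<open>At a detectable position two members of \<open>X\<close> differ, so both
      binary symbols occur there and the value of \<open>y\<close> is among them.\<close>
    have "wdesc 2 n X \<subseteq> desc 2 n X"
    proof
      fix y assume y: "y \<in> wdesc 2 n X"
      have "y i \<in> (\<lambda>c. c i) ` X" if i: "i \<in> {1..n}" for i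
      proof (cases "i \<in> undetectable n X")
        case True
        then show ?thesis
          using y X(1) unfolding wdesc_def by fastforce
      next
        case False
        then obtain c d where cd: "c \<in> X" "d \<in> X" "c i \<noteq> d i"
          using i unfolding undetectable_def by blast
        have lt: "z i < 2" if "z \<in> words 2 n" for z
          using that i unfolding words_def by fastforce
        have "c i < 2" "d i < 2" "y i < 2"
          using cd X(2) C y by (auto intro!: lt simp: wdesc_def)
        then have "y i = c i \<or> y i = d i"
          using cd(3) by linarith
        then show ?thesis
          using cd by blast
      qed
      then show "y \<in> desc 2 n X"
        using y unfolding wdesc_def desc_def by blast
    qed
    then show "wdesc 2 n X \<inter> C \<subseteq> X"
      using assms X unfolding binary_frameproof_def by blast
    show "X \<subseteq> wdesc 2 n X \<inter> C"
      using X(2) C unfolding wdesc_def undetectable_def by auto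
  qed
  then show ?thesis
    using C unfolding wide_sense_frameproof_def by blast
qed

lemma card_le_max_wide_sense:
  "wide_sense_frameproof q n t C \<Longrightarrow> card C \<le> max_wide_sense q n t"
  unfolding max_wide_sense_def by (rule Max_ge[OF finite_sizes_wide_sense]) auto

lemma max_wide_sense_attained:
  obtains C where "wide_sense_frameproof q n t C" "max_wide_sense q n t = card C"
  using Max_in[OF finite_sizes_wide_sense sizes_wide_sense_nonempty, of q n t]
  unfolding max_wide_sense_def by auto

lemma max_binary_le_max_wide_sense: "max_binary n t \<le> max_wide_sense 2 n t"
proof -
  obtain C where "binary_frameproof n t C" "max_binary n t = card C"
    using Max_in[OF finite_sizes_binary sizes_binary_nonempty] unfolding max_binary_def by blast
  then show ?thesis
    using card_le_max_wide_sense binary_frameproof_wide_sense by metis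
qed

section \<open>From finite bounds to the exponential rate\<close>

lemma limsup_log_quotient_le:
  fixes m :: "nat \<Rightarrow> nat" and K a :: real
  assumes m: "\<And>n. real (m n) \<le> K * (1 + real n)\<^sup>2 * exp (a * real n)" and K: "1 \<le> K" and a: "0 \<le> a"
  shows "limsup (\<lambda>n. ereal (log 2 (real (m n)) / real n)) \<le> ereal (a / ln 2)"
proof -
  define u where "u = (\<lambda>n. log 2 (K * (1 + real n)\<^sup>2) / real n + a / ln 2)"
  have "log 2 (real (m n)) / real n \<le> u n" if n: "n > 0" for n
  proof -
    have pos: "1 * 1 \<le> K * (1 + real n)\<^sup>2"
      using K one_le_power[of "1 + real n" 2] by (intro mult_mono) auto
    have one: "1 * 1 \<le> (K * (1 + real n)\<^sup>2) * exp (a * real n)"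
      using pos a by (intro mult_mono) auto
    have "log 2 (real (m n)) \<le> log 2 (K * (1 + real n)\<^sup>2 * exp (a * real n))"
    proof (cases "m n = 0")
      \<comment> \<open>Here \<open>log 2 0\<close> is 0 by convention, so the right-hand logarithm
        must be nonnegative; this is what \<open>one\<close> provides.\<close>
      case True
      then show ?thesis
        using one by (simp add: log_def)
    next
      case False
      then show ?thesis
        using m[of n] one by (subst log_le_cancel_iff) auto
    qed
    also have "\<dots> = log 2 (K * (1 + real n)\<^sup>2) + a * real n / ln 2"
      using pos K by (simp add: log_def ln_mult add_divide_distrib)
    finally show ?thesis
      using n by (simp add: u_def field_simps)
  qed
  then have "limsup (\<lambda>n. ereal (log 2 (real (m n)) / real n)) \<le> limsup (\<lambda>n. ereal (u n))"
    by (intro Limsup_mono) (auto intro: eventually_mono[OF eventually_gt_at_top[of 0]])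
  also have "(\<lambda>n. ereal (u n)) \<longlonglongrightarrow> ereal (a / ln 2)"
  proof -
    have "(\<lambda>n. log 2 (K * (1 + real n)\<^sup>2) / real n) \<longlonglongrightarrow> 0"
      using K by real_asymp
    then have "u \<longlonglongrightarrow> 0 + a / ln 2"
      unfolding u_def by (intro tendsto_intros)
    then show ?thesis by simp
  qed
  then have "limsup (\<lambda>n. ereal (u n)) = ereal (a / ln 2)"
    by (intro lim_imp_Limsup) auto
  finally show ?thesis .
qed

text \<open>For \<open>t = 2\<close> the rate \<open>dr_rate 1\<close> has the junk value \<open>0\<close>, and the trivial bound
  \<open>2 ^ n\<close> on the size of a set family is used instead.\<close>

definition frameproof_rate :: "nat \<Rightarrow> real" where
  "frameproof_rate t = (if t = 2 then ln 2 else dr_rate (t - 1))"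

lemma max_wide_sense_le:
  assumes "t \<ge> 2"
  shows "real (max_wide_sense q n t)
    \<le> 4 * real t * (1 + real n)\<^sup>2 * exp (frameproof_rate t * real n)"
proof -
  obtain s where s: "t = Suc s" "s \<ge> 1"
    using assms by (cases t) auto
  obtain C where C: "wide_sense_frameproof q n (Suc s) C" "max_wide_sense q n t = card C"
    using max_wide_sense_attained s(1) by metis
  let ?E = "exp (frameproof_rate t * real n)"
  let ?b = "3 * real s * (1 + real n)\<^sup>2 * ?E"
  have n1: "1 \<le> (1 + real n)\<^sup>2"
    by (simp add: one_le_power)
  have "0 \<le> frameproof_rate t"
    using s by (auto simp: frameproof_rate_def dr_rate_def)
  then have E1: "1 \<le> ?E"
    by simp
  have "real (card C) \<le> 1 + ?b"
  proof (rule card_wide_sense_frameproof[OF C(1) s(2)])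
    fix F :: "nat set set" assume F: "cover_free s F" "F \<subseteq> Pow {1..n}"
    show "real (card F) \<le> ?b"
    proof (cases "s = 1")
      case True
      have "card F \<le> 2 ^ n"
        using card_mono[OF _ F(2)] by (simp add: card_Pow)
      then have "real (card F) \<le> 2 ^ n"
        by (metis of_nat_le_iff of_nat_numeral of_nat_power)
      also have "2 ^ n = ?E"
        using True s(1) by (simp add: frameproof_rate_def exp_of_nat2_mult)
      also have "1 * ?E \<le> (3 * real s * (1 + real n)\<^sup>2) * ?E"
      proof (rule mult_right_mono)
        have "1 * 1 \<le> (3 * real s) * (1 + real n)\<^sup>2"
          using s(2) n1 by (intro mult_mono) auto
        then show "1 \<le> 3 * real s * (1 + real n)\<^sup>2" by simp
      qed simp
      finally show ?thesis by simp
    next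
      case False
      then show ?thesis
        using card_cover_free[of s F "{1..n}"] F s by (simp add: frameproof_rate_def)
    qed
  qed simp
  also have "\<dots> \<le> 4 * real t * (1 + real n)\<^sup>2 * ?E"
  proof -
    have "1 * 1 \<le> (1 + real n)\<^sup>2 * ?E"
      using n1 E1 by (intro mult_mono) auto
    moreover have "0 \<le> real s * ((1 + real n)\<^sup>2 * ?E)"
      by simp
    ultimately have "1 + 3 * (real s * ((1 + real n)\<^sup>2 * ?E))
        \<le> 4 * (real s * ((1 + real n)\<^sup>2 * ?E)) + 4 * ((1 + real n)\<^sup>2 * ?E)"
      by linarith
    also have "\<dots> = 4 * real t * (1 + real n)\<^sup>2 * ?E"
      unfolding s(1) by (simp add: algebra_simps)
    finally show ?thesis
      by (simp add: mult_ac)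
  qed
  finally show ?thesis
    using C(2) by simp
qed

theorem theorem1p10:
  fixes q :: nat
  assumes "q \<ge> 2"
  shows "\<exists>\<epsilon> :: nat \<Rightarrow> real. \<epsilon> \<longlonglongrightarrow> 0 \<and>
    (\<forall>t\<ge>2.
       limsup (\<lambda>n. ereal (log 2 (real (max_wide_sense q n t)) / real n))
         \<le> ereal ((2 + \<epsilon> t) * (log 2 (real t) / (real t)\<^sup>2)) \<and>
       (q = 2 \<longrightarrow>
         limsup (\<lambda>n. ereal (log 2 (real (max_binary n t)) / real n))
           \<le> ereal ((2 + \<epsilon> t) * (log 2 (real t) / (real t)\<^sup>2))))"
proof -
  \<comment> \<open>Chosen so that the claimed bound equals \<open>frameproof_rate t / ln 2\<close>
    exactly. What remains is that \<open>dr_rate (t - 1)\<close> is asymptotic to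
    \<open>2 * ln t / t^2\<close>; the special value at \<open>t = 2\<close> does not affect the
    limit.\<close>
  define \<epsilon> where "\<epsilon> = (\<lambda>t. frameproof_rate t * (real t)\<^sup>2 / ln (real t) - 2)"
  have rate: "(2 + \<epsilon> t) * (log 2 (real t) / (real t)\<^sup>2) = frameproof_rate t / ln 2" if "t \<ge> 2" for t
    using that by (simp add: \<epsilon>_def log_def)
  have "(\<lambda>t. 2 * (1 + ln (real t - 1)) / ((real t - 1) * (real t - 1 - 1)) * (real t)\<^sup>2 / ln (real t) - 2)
      \<longlonglongrightarrow> 0"
    by real_asymp
  then have "\<epsilon> \<longlonglongrightarrow> 0"
    by (rule Lim_transform_eventually)
      (auto simp: \<epsilon>_def frameproof_rate_def dr_rate_def of_nat_diff
        intro!: eventually_mono[OF eventually_gt_at_top[of 2]])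
  moreover have "limsup (\<lambda>n. ereal (log 2 (real (max_wide_sense q n t)) / real n))
      \<le> ereal ((2 + \<epsilon> t) * (log 2 (real t) / (real t)\<^sup>2))"
    and "q = 2 \<longrightarrow> limsup (\<lambda>n. ereal (log 2 (real (max_binary n t)) / real n))
      \<le> ereal ((2 + \<epsilon> t) * (log 2 (real t) / (real t)\<^sup>2))" if t: "t \<ge> 2" for t
  proof -
    have K: "1 \<le> 4 * real t" "0 \<le> frameproof_rate t"
      using t by (auto simp: frameproof_rate_def dr_rate_def of_nat_diff)
    show "limsup (\<lambda>n. ereal (log 2 (real (max_wide_sense q n t)) / real n))
        \<le> ereal ((2 + \<epsilon> t) * (log 2 (real t) / (real t)\<^sup>2))"
      unfolding rate[OF t] by (rule limsup_log_quotient_le[OF max_wide_sense_le[OF t] K])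
    have "real (max_binary n t) \<le> 4 * real t * (1 + real n)\<^sup>2 * exp (frameproof_rate t * real n)" for n
      using max_binary_le_max_wide_sense[of n t] max_wide_sense_le[OF t, of 2 n] by linarith
    then show "q = 2 \<longrightarrow> limsup (\<lambda>n. ereal (log 2 (real (max_binary n t)) / real n))
        \<le> ereal ((2 + \<epsilon> t) * (log 2 (real t) / (real t)\<^sup>2))"
      unfolding rate[OF t] by (intro impI limsup_log_quotient_le[OF _ K])
  qed
  ultimately show ?thesis
    by blast
qed

end
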